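(* Let $\mathcal{P}$ be a finite poset whose underlying comparability graph has $m\ge 1$ edges. Then $\operatorname{ldim}(\mathcal{P})\le \left(2^{13\log^{*}\sqrt{m}}+2\right)2\sqrt{m}+1$.
   Context: All posets are finite. The underlying comparability graph of a poset $\mathcal{P}=(X,\preceq)$ is the simple graph with vertex set $X$ in which two distinct elements are adjacent if and only if they are comparable in $\mathcal{P}$. A partial linear extension (ple) of $\mathcal{P}$ is a linear extension of any subposet of $\mathcal{P}$. A local realizer of $\mathcal{P}$ is a family $\mathcal{L}=\{L_1,\dots,L_l\}$ of ple's of $\mathcal{P}$ such that (1) if $x\preceq y$ in $\mathcal{P}$ then there is at least one $L_i\in\mathcal{L}$ with $x\preceq_{L_i}y$; and (2) if $x$ and $y$ are incomparable in $\mathcal{P}$ then there are $L_i,L_j\in\mathcal{L}$ with $x\preceq_{L_i}y$ and $y\preceq_{L_j}x$. Here $x\preceq_{L}y$ means that both $x,y$ are elements of $L$ and $x\preceq y$ in $L$. For $x\in X$ let $\mu_x(\mathcal{L})$ be the number of ple's in $\mathcal{L}$ that contain $x$, and let $\mu(\mathcal{L})=\max_x\mu_x(\mathcal{L})$. The local dimension $\operatorname{ldim}(\mathcal{P})$ is the minimum of $\mu(\mathcal{L})$ over all local realizers $\mathcal{L}$ of $\mathcal{P}$. Logarithms are to base $2$, and $\log^{*}x$ denotes the iterated logarithm: the number of times $\log$ must be applied, starting from $x$, to obtain a result less than or equal to $1$ (so $\log^* x=0$ for $x\le 1$). *)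

theory Defs
  imports Complex_Main
begin

text \<open>A poset is a carrier \<open>X\<close> with a relation \<open>r\<close> such that \<^term>\<open>partial_order_on X r\<close>; both
  partial and linear orders are reflexive, so a linear order determines its ground set as
  its \<^const>\<open>Field\<close>.\<close>

definition comparability_edges :: "'a set \<Rightarrow> 'a rel \<Rightarrow> 'a set set" where
  "comparability_edges X r =
     {{x, y} | x y. x \<in> X \<and> y \<in> X \<and> x \<noteq> y \<and> ((x, y) \<in> r \<or> (y, x) \<in> r)}"

definition linear_extension :: "'a set \<Rightarrow> 'a rel \<Rightarrow> 'a rel \<Rightarrow> bool" where
  "linear_extension Y s L \<longleftrightarrow> linear_order_on Y L \<and> s \<subseteq> L"

text \<open>Subposets are induced: the subposet on \<open>Y\<close> carries the restriction of \<open>r\<close> to \<open>Y\<close>.\<close>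

definition ple :: "'a set \<Rightarrow> 'a rel \<Rightarrow> 'a rel \<Rightarrow> bool" where
  "ple X r L \<longleftrightarrow> (\<exists>Y \<subseteq> X. linear_extension Y (Restr r Y) L)"

text \<open>A family of ple's is a list, so that repetitions are allowed and counted.\<close>

definition local_realizer :: "'a set \<Rightarrow> 'a rel \<Rightarrow> 'a rel list \<Rightarrow> bool" where
  "local_realizer X r Ls \<longleftrightarrow>
     (\<forall>L \<in> set Ls. ple X r L) \<and>
     (\<forall>x \<in> X. \<forall>y \<in> X. (x, y) \<in> r \<longrightarrow> (\<exists>L \<in> set Ls. (x, y) \<in> L)) \<and>
     (\<forall>x \<in> X. \<forall>y \<in> X. (x, y) \<notin> r \<and> (y, x) \<notin> r \<longrightarrow>
        (\<exists>L \<in> set Ls. \<exists>L' \<in> set Ls. (x, y) \<in> L \<and> (y, x) \<in> L'))"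

definition multiplicity_at :: "'a rel list \<Rightarrow> 'a \<Rightarrow> nat" where
  "multiplicity_at Ls x = length (filter (\<lambda>L. x \<in> Field L) Ls)"

text \<open>Only meaningful for finite nonempty \<open>X\<close>, as \<^const>\<open>Max\<close> is unspecified otherwise.\<close>

definition max_multiplicity :: "'a set \<Rightarrow> 'a rel list \<Rightarrow> nat" where
  "max_multiplicity X Ls = Max (multiplicity_at Ls ` X)"

text \<open>The minimum exists for every finite poset, since finite posets have realizers.\<close>

definition ldim :: "'a set \<Rightarrow> 'a rel \<Rightarrow> nat" where
  "ldim X r = (LEAST k. \<exists>Ls. local_realizer X r Ls \<and> max_multiplicity X Ls = k)"

text \<open>Iterates preceding the first one that is at most 1 are greater than 1, so the value of
  \<^const>\<open>log\<close> at nonpositive arguments plays no role.\<close>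

definition log_star :: "real \<Rightarrow> nat" where
  "log_star x = (LEAST k. (log 2 ^^ k) x \<le> 1)"

end

theory Submission
  imports Defs "HOL-Library.FuncSet"
begin

text \<open>In fact \<open>ldim\<close> is at most \<open>104 * sqrt m + 4\<close>, without any iterated logarithm. Choose \<open>k\<close>
  with \<open>2 ^ k\<close> close to \<open>sqrt m\<close> and call an element heavy if its degree is at least about
  \<open>2 ^ k / k\<close>. There are \<open>O(k * sqrt m)\<close> heavy elements; cutting them into groups of size \<open>k\<close>, the
  pairs with a heavy element are handled by covering the incomparability relation between each
  group and all of \<open>X\<close> by bicliques. Since only \<open>O(m)\<close> elements are not isolated, the pairs of
  light ones are handled by \<open>O((2 ^ k / k) * log m)\<close>, that is \<open>O(sqrt m)\<close>, random linear extensions.\<close>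

section \<open>Building linear extensions by stacking\<close>

text \<open>All of \<open>A\<close> may be placed below all of \<open>B\<close> because no element
  of \<open>B\<close> lies below one of \<open>A\<close> in \<open>r\<close>. This is the means of
  assembling the extensions used below.\<close>

lemma linear_extension_concat:
  assumes L: "linear_extension A (Restr r A) L" and M: "linear_extension B (Restr r B) M"
    and disj: "A \<inter> B = {}" and no: "\<And>a b. a \<in> A \<Longrightarrow> b \<in> B \<Longrightarrow> (b, a) \<notin> r"
  shows "linear_extension (A \<union> B) (Restr r (A \<union> B)) (L \<union> M \<union> A \<times> B)"
proof -
  have l: "L \<subseteq> A \<times> A" "refl_on A L" "trans L" "antisym L" "total_on A L" "Restr r A \<subseteq> L"
    using L unfolding linear_extension_def linear_order_on_def partial_order_on_def preorder_on_def
    by auto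
  have m: "M \<subseteq> B \<times> B" "refl_on B M" "trans M" "antisym M" "total_on B M" "Restr r B \<subseteq> M"
    using M unfolding linear_extension_def linear_order_on_def partial_order_on_def preorder_on_def
    by auto
  let ?N = "L \<union> M \<union> A \<times> B"
  have "?N \<subseteq> (A \<union> B) \<times> (A \<union> B)" using l(1) m(1) by auto
  moreover have "refl_on (A \<union> B) ?N" using l(2) m(2) unfolding refl_on_def by auto
  moreover have "trans ?N"
  proof (rule transI)
    fix x y z assume "(x, y) \<in> ?N" "(y, z) \<in> ?N"
    then show "(x, z) \<in> ?N"
      using l(1) m(1) disj transD[OF l(3)] transD[OF m(3)] by (elim UnE) blast+
  qed
  moreover have "antisym ?N"
  proof (rule antisymI)
    fix x y assume "(x, y) \<in> ?N" "(y, x) \<in> ?N"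
    then show "x = y"
      using l(1) m(1) disj antisymD[OF l(4)] antisymD[OF m(4)] by (elim UnE) blast+
  qed
  moreover have "total_on (A \<union> B) ?N" using l(5) m(5) unfolding total_on_def by blast
  moreover have "Restr r (A \<union> B) \<subseteq> ?N" using l(6) m(6) no by blast
  ultimately show ?thesis
    unfolding linear_extension_def linear_order_on_def partial_order_on_def preorder_on_def by blast
qed

text \<open>A minimal element of \<open>Y\<close> is stacked below an extension of the remaining
  elements.\<close>

lemma linear_extension_exists:
  assumes "finite Y" "antisym r" "trans r"
  shows "\<exists>L. linear_extension Y (Restr r Y) L"
  using assms(1)
proof (induction Y rule: finite_psubset_induct)
  case (psubset Y)
  show ?case
  proof (cases "Y = {}")
    case True
    then show ?thesis
      by (intro exI[of _ "{}"])
        (auto simp: linear_extension_def linear_order_on_def partial_order_on_def preorder_on_def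
          refl_on_def trans_def antisym_def total_on_def)
  next
    case False
    have "asymp_on Y (\<lambda>a b. (a, b) \<in> r \<and> a \<noteq> b)"
      using assms(2) by (auto simp: asymp_on_def dest: antisymD)
    moreover have "transp_on Y (\<lambda>a b. (a, b) \<in> r \<and> a \<noteq> b)"
      using assms(2,3) by (auto simp: transp_on_def dest: transD antisymD)
    ultimately obtain y where y: "y \<in> Y" "\<forall>x\<in>Y. x \<noteq> y \<longrightarrow> \<not> ((x, y) \<in> r \<and> x \<noteq> y)"
      using Finite_Set.bex_min_element[OF psubset.hyps(1) _ _ False] by blast
    from y(1) have "Y - {y} \<subset> Y" by auto
    from psubset.IH[OF this] obtain L where L: "linear_extension (Y - {y}) (Restr r (Y - {y})) L"
      by blast
    have "linear_extension {y} (Restr r {y}) {(y, y)}"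
      by (auto simp: linear_extension_def linear_order_on_def partial_order_on_def preorder_on_def
          refl_on_def trans_def antisym_def total_on_def)
    from linear_extension_concat[OF this L] y have
      "linear_extension ({y} \<union> (Y - {y})) (Restr r ({y} \<union> (Y - {y}))) ({(y, y)} \<union> L \<union> {y} \<times> (Y - {y}))"
      by auto
    moreover have "{y} \<union> (Y - {y}) = Y" using y(1) by auto
    ultimately show ?thesis by metis
  qed
qed

lemma partial_order_onD_set:
  assumes "partial_order_on X r"
  shows "r \<subseteq> X \<times> X" "refl_on X r" "antisym r" "trans r"
  using assms unfolding partial_order_on_def preorder_on_def by auto

lemma linear_extension_Field:
  "linear_extension Y s L \<Longrightarrow> Field L = Y"
  unfolding linear_extension_def linear_order_on_def partial_order_on_def preorder_on_def
  by (auto simp: Field_def refl_on_def)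

text \<open>Realises a whole biclique \<open>A \<times> B\<close> by one ple that costs multiplicity
  only at the elements of \<open>A \<union> B\<close>; for \<open>A \<union> B = X\<close> it is a
  linear extension of the whole poset.\<close>

lemma ple_separating:
  assumes "finite X" "partial_order_on X r" "A \<subseteq> X" "B \<subseteq> X" "A \<inter> B = {}"
    and "\<And>a b. a \<in> A \<Longrightarrow> b \<in> B \<Longrightarrow> (b, a) \<notin> r"
  shows "\<exists>L. ple X r L \<and> Field L = A \<union> B \<and> A \<times> B \<subseteq> L"
proof -
  note po = partial_order_onD_set[OF assms(2)]
  have "finite A" "finite B" using assms(1,3,4) finite_subset by auto
  then obtain L M where "linear_extension A (Restr r A) L" "linear_extension B (Restr r B) M"
    using linear_extension_exists po by metis
  from linear_extension_concat[OF this assms(5,6)]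
  have N: "linear_extension (A \<union> B) (Restr r (A \<union> B)) (L \<union> M \<union> A \<times> B)" by blast
  then have "ple X r (L \<union> M \<union> A \<times> B)" using assms(3,4) unfolding ple_def by (meson Un_least)
  then show ?thesis using N linear_extension_Field[OF N] unfolding linear_extension_def by blast
qed

section \<open>Multiplicities of families of ple's\<close>

lemma multiplicity_at_append [simp]:
  "multiplicity_at (Ls @ Ms) x = multiplicity_at Ls x + multiplicity_at Ms x"
  by (simp add: multiplicity_at_def)

lemma multiplicity_at_le_length: "multiplicity_at Ls x \<le> length Ls"
  by (simp add: multiplicity_at_def)

text \<open>A ple that arises from two indices is listed twice, so the multiplicity counts indices
  rather than distinct ple's.\<close>

lemma family_list:
  assumes "finite I"
  shows "\<exists>Ls. set Ls = f ` I \<and> (\<forall>x. multiplicity_at Ls x = card {i \<in> I. x \<in> Field (f i)})"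
proof -
  obtain xs where xs: "set xs = I" "distinct xs" using finite_distinct_list[OF assms] by blast
  have "multiplicity_at (map f xs) x = card {i \<in> I. x \<in> Field (f i)}" for x
    using distinct_length_filter[OF xs(2)] xs(1)
    by (simp add: multiplicity_at_def filter_map comp_def Int_def conj_commute)
  then show ?thesis using xs(1) by (intro exI[of _ "map f xs"]) auto
qed

lemma ldim_le:
  assumes "finite X" "X \<noteq> {}" "local_realizer X r Ls" "\<And>x. multiplicity_at Ls x \<le> b"
  shows "ldim X r \<le> b"
proof -
  have "ldim X r \<le> max_multiplicity X Ls"
    unfolding ldim_def by (rule Least_le) (use assms(3) in blast)
  also have "\<dots> \<le> b" unfolding max_multiplicity_def using assms by (subst Max_le_iff) auto
  finally show ?thesis .
qed

section \<open>Biclique covers for pairs with a heavy element\<close>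

definition incomparable :: "'a rel \<Rightarrow> 'a \<Rightarrow> 'a \<Rightarrow> bool" where
  "incomparable r x y \<longleftrightarrow> (x, y) \<notin> r \<and> (y, x) \<notin> r"

lemma incomparable_commute: "incomparable r x y \<longleftrightarrow> incomparable r y x"
  by (auto simp: incomparable_def)

text \<open>Numbering \<open>H\<close> from 0 and dividing the numbers by \<open>k\<close> gives
  blocks of consecutive numbers; the index \<open>card H div k\<close> leaves room for an incomplete
  last block.\<close>

lemma ex_small_groups:
  assumes "finite H" "k \<ge> 1"
  shows "\<exists>h :: 'a \<Rightarrow> nat. h ` H \<subseteq> {..card H div k} \<and> (\<forall>i. card {x \<in> H. h x = i} \<le> k)"
proof -
  obtain e where e: "bij_betw e H {0..<card H}" using ex_bij_betw_finite_nat[OF assms(1)] by blast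
  have "card {x \<in> H. e x div k = i} \<le> k" for i
  proof -
    have "card {x \<in> H. e x div k = i} = card (e ` {x \<in> H. e x div k = i})"
      using e by (intro card_image[symmetric]) (auto simp: bij_betw_def inj_on_def)
    also have "\<dots> \<le> card {i * k..<i * k + k}"
    proof (intro card_mono)
      have "a div k * k \<le> a" "a < a div k * k + k" for a
        using assms(2) dividend_less_div_times[of k a] by (simp_all add: add.commute)
      then show "e ` {x \<in> H. e x div k = i} \<subseteq> {i * k..<i * k + k}" by auto
    qed simp
    finally show ?thesis by simp
  qed
  moreover have "(\<lambda>x. e x div k) ` H \<subseteq> {..card H div k}"
  proof -
    have "e x \<le> card H" if "x \<in> H" for x using bij_betwE[OF e] that by fastforce
    then show ?thesis by (auto intro: div_le_mono)
  qed
  ultimately show ?thesis by (intro exI[of _ "\<lambda>x. e x div k"]) blast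
qed

text \<open>The set \<open>H\<close> is cut into groups of at most \<open>k\<close> elements. Every \<open>x\<close> determines, in each group,
  the set \<open>S\<close> of elements incomparable to it, and so is placed against one \<open>S\<close> per group only, while an
  element of \<open>H\<close> lies in at most \<open>2 ^ k\<close> subsets of its group.\<close>

lemma grouped_ples:
  assumes X: "finite X" "partial_order_on X r" and H: "H \<subseteq> X" and k: "k \<ge> 1"
  shows "\<exists>Ls. (\<forall>L\<in>set Ls. ple X r L) \<and>
    (\<forall>x\<in>H. \<forall>y\<in>X. incomparable r x y \<longrightarrow> (\<exists>L\<in>set Ls. (x, y) \<in> L) \<and> (\<exists>L\<in>set Ls. (y, x) \<in> L)) \<and>
    (\<forall>x. multiplicity_at Ls x \<le> 2 * (card H div k + 1 + 2 ^ k))"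
proof -
  note po = partial_order_onD_set[OF X(2)]
  have finH: "finite H" using H X(1) finite_subset by blast
  obtain h :: "'a \<Rightarrow> nat" where h: "h ` H \<subseteq> {..card H div k}" "\<And>i. card {x \<in> H. h x = i} \<le> k"
    using ex_small_groups[OF finH k] by blast
  define A where "A i = {x \<in> H. h x = i}" for i
  \<comment> \<open>Demanding equality with \<open>S\<close>, not mere inclusion, makes the sets
    \<open>B (i, S)\<close> disjoint for fixed \<open>i\<close>; the multiplicity bound rests on
    this.\<close>
  define B where "B = (\<lambda>(i, S). {y \<in> X. {x \<in> A i. incomparable r x y} = S})"
  define I where "I = (SIGMA i:{..card H div k}. Pow (A i))"
  have finA: "finite (A i)" for i using finH by (simp add: A_def)
  have finI: "finite I" unfolding I_def using finA by simp
  have inc: "incomparable r x y" if "j \<in> I" "x \<in> snd j" "y \<in> B j" for j x y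
    using that by (auto simp: B_def I_def)
  have SX: "snd j \<subseteq> X" if "j \<in> I" for j using that H by (auto simp: I_def A_def)
  have BX: "B j \<subseteq> X" for j by (auto simp: B_def split: prod.splits)
  have disj: "snd j \<inter> B j = {}" if "j \<in> I" for j
  proof -
    have "\<not> incomparable r x x" if "x \<in> X" for x
      using po(2) that by (auto simp: incomparable_def refl_on_def)
    then show ?thesis using inc[OF that] SX[OF that] by blast
  qed
  have "\<exists>L. ple X r L \<and> Field L = snd j \<union> B j \<and> snd j \<times> B j \<subseteq> L" if "j \<in> I" for j
    using ple_separating[OF X SX[OF that] BX disj[OF that]] inc[OF that]
    unfolding incomparable_def by blast
  then obtain f where f: "\<And>j. j \<in> I \<Longrightarrow> ple X r (f j) \<and> Field (f j) = snd j \<union> B j \<and> snd j \<times> B j \<subseteq> f j"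
    by metis
  have "\<exists>L. ple X r L \<and> Field L = B j \<union> snd j \<and> B j \<times> snd j \<subseteq> L" if "j \<in> I" for j
    using ple_separating[OF X BX SX[OF that]] disj[OF that] inc[OF that]
    unfolding incomparable_def by blast
  then obtain g where g: "\<And>j. j \<in> I \<Longrightarrow> ple X r (g j) \<and> Field (g j) = B j \<union> snd j \<and> B j \<times> snd j \<subseteq> g j"
    by metis
  have bound: "card {j \<in> I. x \<in> snd j \<union> B j} \<le> card H div k + 1 + 2 ^ k" for x
  proof -
    \<comment> \<open>\<open>?P\<close> contains the indices with \<open>x\<close> in
      \<open>B j\<close>, at most one per group. \<open>?R\<close> contains those with
      \<open>x\<close> in \<open>snd j\<close>, all of which belong to the group of
      \<open>x\<close>.\<close>
    let ?P = "(\<lambda>i. (i, {a \<in> A i. incomparable r a x})) ` {..card H div k}"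
    let ?R = "{h x} \<times> Pow (A (h x))"
    have "{j \<in> I. x \<in> snd j \<union> B j} \<subseteq> ?P \<union> ?R"
    proof (rule subsetI)
      fix j assume j: "j \<in> {j \<in> I. x \<in> snd j \<union> B j}"
      show "j \<in> ?P \<union> ?R"
      proof (cases "x \<in> snd j")
        case True
        then have "fst j = h x" "snd j \<subseteq> A (fst j)" using j by (auto simp: I_def A_def)
        then show ?thesis by (cases j) auto
      next
        case False
        then show ?thesis using j by (auto simp: I_def B_def)
      qed
    qed
    then have "card {j \<in> I. x \<in> snd j \<union> B j} \<le> card (?P \<union> ?R)"
      using finA by (intro card_mono) auto
    also have "\<dots> \<le> card ?P + card ?R" by (rule card_Un_le)
    also have "card ?P \<le> card H div k + 1" using card_image_le[of "{..card H div k}"] by auto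
    also have "card ?R \<le> 2 ^ k" using finA h(2) by (auto simp: card_Pow A_def intro!: power_increasing)
    finally show ?thesis by simp
  qed
  obtain Fs where Fs: "set Fs = f ` I" "\<And>x. multiplicity_at Fs x = card {i \<in> I. x \<in> Field (f i)}"
    using family_list[OF finI] by blast
  obtain Gs where Gs: "set Gs = g ` I" "\<And>x. multiplicity_at Gs x = card {i \<in> I. x \<in> Field (g i)}"
    using family_list[OF finI] by blast
  have "multiplicity_at Fs x \<le> card H div k + 1 + 2 ^ k" for x
  proof -
    have "{i \<in> I. x \<in> Field (f i)} = {j \<in> I. x \<in> snd j \<union> B j}" using f by blast
    then show ?thesis using bound Fs(2) by simp
  qed
  moreover have "multiplicity_at Gs x \<le> card H div k + 1 + 2 ^ k" for x
  proof -
    have "{i \<in> I. x \<in> Field (g i)} = {j \<in> I. x \<in> snd j \<union> B j}" using g by blast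
    then show ?thesis using bound Gs(2) by simp
  qed
  ultimately have "multiplicity_at (Fs @ Gs) x \<le> 2 * (card H div k + 1 + 2 ^ k)" for x
    unfolding multiplicity_at_append mult_2 by (intro add_mono)
  moreover have "\<forall>L\<in>set (Fs @ Gs). ple X r L" using f g Fs(1) Gs(1) by auto
  moreover have "(\<exists>L\<in>set (Fs @ Gs). (x, y) \<in> L) \<and> (\<exists>L\<in>set (Fs @ Gs). (y, x) \<in> L)"
    if "x \<in> H" "y \<in> X" "incomparable r x y" for x y
  proof -
    \<comment> \<open>The index serving the pair is the group of \<open>x\<close> with the trace of
      \<open>y\<close> on it; \<open>f\<close> puts \<open>x\<close> below \<open>y\<close>, and
      \<open>g\<close> does the reverse.\<close>
    let ?j = "(h x, {a \<in> A (h x). incomparable r a y})"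
    have j: "?j \<in> I" "x \<in> snd ?j" "y \<in> B ?j" using that h(1) by (auto simp: I_def A_def B_def)
    have "(x, y) \<in> snd ?j \<times> B ?j" "(y, x) \<in> B ?j \<times> snd ?j" using j(2,3) by (simp_all only: mem_Sigma_iff)
    then have "(x, y) \<in> f ?j" "(y, x) \<in> g ?j" using f[OF j(1)] g[OF j(1)] by blast+
    moreover have "f ?j \<in> set (Fs @ Gs)" "g ?j \<in> set (Fs @ Gs)"
      unfolding set_append Fs(1) Gs(1) using j(1) by blast+
    ultimately show ?thesis by blast
  qed
  ultimately show ?thesis by blast
qed

section \<open>Random linear extensions, by counting\<close>

text \<open>Averaging replaces probability: some \<open>f\<close> satisfies at least a share
  \<open>p\<close> of the \<open>q\<close> still uncovered, so each of the \<open>t\<close> rounds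
  can shrink their number by a factor \<open>1 - p\<close>.\<close>

lemma greedy_cover:
  fixes p :: real
  assumes "finite F" "F \<noteq> {}" "finite Q" "0 \<le> p" "p \<le> 1"
    and sat: "\<And>q. q \<in> Q \<Longrightarrow> p * card F \<le> card {f \<in> F. P f q}"
  shows "\<exists>fs. set fs \<subseteq> F \<and> length fs = t \<and>
    real (card {q \<in> Q. \<forall>f\<in>set fs. \<not> P f q}) \<le> (1 - p) ^ t * card Q"
proof (induction t)
  case 0
  then show ?case by (intro exI[of _ "[]"]) auto
next
  case (Suc t)
  then obtain fs where fs: "set fs \<subseteq> F" "length fs = t"
    "real (card {q \<in> Q. \<forall>f\<in>set fs. \<not> P f q}) \<le> (1 - p) ^ t * card Q" by blast
  define R where "R = {q \<in> Q. \<forall>f\<in>set fs. \<not> P f q}"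
  have finR: "finite R" using assms(3) by (simp add: R_def)
  \<comment> \<open>Otherwise counting the pairs \<open>(f, q)\<close> with \<open>P f q\<close> by
    \<open>f\<close> gives less than \<open>p * card F * card R\<close>, whereas counting by
    \<open>q\<close> gives at least that.\<close>
  have "\<exists>f\<in>F. p * card R \<le> card {q \<in> R. P f q}"
  proof (rule ccontr)
    assume "\<not> ?thesis"
    then have "(\<Sum>f\<in>F. real (card {q \<in> R. P f q})) < (\<Sum>f\<in>F. p * card R)"
      using assms(1,2) by (intro sum_strict_mono) auto
    also have "\<dots> = (\<Sum>q\<in>R. p * card F)" by simp
    also have "\<dots> \<le> (\<Sum>q\<in>R. real (card {f \<in> F. P f q}))"
      using sat by (intro sum_mono) (auto simp: R_def)
    also have "\<dots> = (\<Sum>f\<in>F. real (card {q \<in> R. P f q}))"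
      using sum.swap_restrict[OF finR assms(1), of "\<lambda>_ _. 1::real" "\<lambda>q f. P f q"] by simp
    finally show False by simp
  qed
  then obtain f where f: "f \<in> F" "p * card R \<le> card {q \<in> R. P f q}" by blast
  have "{q \<in> Q. \<forall>g\<in>set (f # fs). \<not> P g q} = R - {q \<in> R. P f q}" by (auto simp: R_def)
  then have "real (card {q \<in> Q. \<forall>g\<in>set (f # fs). \<not> P g q}) = real (card R) - card {q \<in> R. P f q}"
    using finR by (simp add: card_Diff_subset card_mono of_nat_diff)
  also have "\<dots> \<le> (1 - p) * card R" using f(2) by (simp add: algebra_simps)
  also have "\<dots> \<le> (1 - p) * ((1 - p) ^ t * card Q)"
    using fs(3) assms(5) by (intro mult_left_mono) (auto simp: R_def)
  finally show ?case using fs(1,2) f(1) by (intro exI[of _ "f # fs"]) auto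
qed

text \<open>In terms of probability, \<open>x\<close> has colour 0 with chance
  \<open>1 / (2 * n)\<close>, and independently \<open>U\<close> avoids colour 0 with chance
  \<open>(1 - 1 / (2 * n)) ^ card U\<close>, which is at least 1/2 by Bernoulli's
  inequality.\<close>

lemma card_avoiding_colourings:
  fixes X :: "'a set"
  assumes "finite X" "x \<in> X" "U \<subseteq> X" "x \<notin> U" "card U \<le> n" "n \<ge> 1"
  shows "real (card (X \<rightarrow>\<^sub>E {..<2 * n})) / (4 * n)
    \<le> card {f \<in> X \<rightarrow>\<^sub>E {..<2 * n}. f x = 0 \<and> (\<forall>z\<in>U. f z \<noteq> 0)}"
proof -
  \<comment> \<open>The requirement restricts each value separately, so the favourable colourings
    form a product set, whose cardinality factors.\<close>
  define B where "B z = (if z = x then {0} else if z \<in> U then {1..<2 * n} else {..<2 * n})" for z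
  have finU: "finite U" using assms(1,3) finite_subset by blast
  have eq: "{f \<in> X \<rightarrow>\<^sub>E {..<2 * n}. f x = 0 \<and> (\<forall>z\<in>U. f z \<noteq> 0)} = Pi\<^sub>E X B"
  proof (intro equalityI subsetI)
    fix f assume f: "f \<in> {f \<in> X \<rightarrow>\<^sub>E {..<2 * n}. f x = 0 \<and> (\<forall>z\<in>U. f z \<noteq> 0)}"
    then show "f \<in> Pi\<^sub>E X B" using assms(2-4) by (auto simp: B_def PiE_def Pi_def Suc_le_eq)
  next
    fix f assume f: "f \<in> Pi\<^sub>E X B"
    have "f z \<in> B z" if "z \<in> X" for z using f that by auto
    moreover have "B z \<subseteq> {..<2 * n}" for z using assms(6) by (auto simp: B_def)
    ultimately have "f \<in> X \<rightarrow>\<^sub>E {..<2 * n}" using f by (auto simp: PiE_def)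
    moreover have "f x = 0" using \<open>\<And>z. z \<in> X \<Longrightarrow> f z \<in> B z\<close>[of x] assms(2) by (simp add: B_def)
    moreover have "f z \<noteq> 0" if "z \<in> U" for z
      using \<open>\<And>z. z \<in> X \<Longrightarrow> f z \<in> B z\<close>[of z] that assms(3,4) by (auto simp: B_def split: if_splits)
    ultimately show "f \<in> {f \<in> X \<rightarrow>\<^sub>E {..<2 * n}. f x = 0 \<and> (\<forall>z\<in>U. f z \<noteq> 0)}" by auto
  qed
  let ?q = "real (2 * n)"
  have Xs: "X = insert x (U \<union> (X - insert x U))" using assms(2,3) by auto
  have spl: "(\<Prod>z\<in>X. g z) = g x * ((\<Prod>z\<in>U. g z) * (\<Prod>z\<in>X - insert x U. g z))" for g :: "'a \<Rightarrow> real"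
    by (subst Xs, subst prod.insert) (use assms(1,4) finU in \<open>auto intro!: prod.union_disjoint\<close>)
  have "real (card (Pi\<^sub>E X B)) = (\<Prod>z\<in>X. real (card (B z)))"
    using assms(1) by (simp add: card_PiE)
  also have "\<dots> = (?q - 1) ^ card U * ?q ^ card (X - insert x U)"
  proof -
    have "(\<Prod>z\<in>U. real (card (B z))) = (\<Prod>z\<in>U. ?q - 1)"
      using assms(4,6) by (intro prod.cong) (auto simp: B_def of_nat_diff)
    moreover have "(\<Prod>z\<in>X - insert x U. real (card (B z))) = (\<Prod>z\<in>X - insert x U. ?q)"
      by (intro prod.cong) (auto simp: B_def)
    ultimately show ?thesis unfolding spl by (simp add: B_def)
  qed
  finally have c1: "real (card (Pi\<^sub>E X B)) = (?q - 1) ^ card U * ?q ^ card (X - insert x U)" .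
  have "real (card (X \<rightarrow>\<^sub>E {..<2 * n})) = (\<Prod>z\<in>X. ?q)" using assms(1) by (simp add: card_PiE)
  then have c2: "real (card (X \<rightarrow>\<^sub>E {..<2 * n})) = ?q * (?q ^ card U * ?q ^ card (X - insert x U))"
    unfolding spl by simp
  have q: "?q > 0" using assms(6) by simp
  \<comment> \<open>Here \<open>card U <= n\<close> enters: half of the \<open>2 * n\<close>
    colours' worth of loss is the most that can occur.\<close>
  have "1 / 2 \<le> 1 + real (card U) * (- 1 / ?q)" using assms(5,6) by (simp add: field_simps)
  also have "\<dots> \<le> (1 + (- 1 / ?q)) ^ card U"
    using assms(6) by (intro Bernoulli_inequality) (auto simp: field_simps)
  also have "1 + (- 1 / ?q) = (?q - 1) / ?q" using q by (simp add: field_simps)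
  finally have "?q ^ card U / 2 \<le> (?q - 1) ^ card U"
    using q by (simp add: power_divide field_simps)
  then have "?q ^ card U / 2 * ?q ^ card (X - insert x U) \<le> (?q - 1) ^ card U * ?q ^ card (X - insert x U)"
    using q by (intro mult_right_mono) auto
  then show ?thesis unfolding eq c1 c2 using assms(6) by (simp add: field_simps)
qed

text \<open>A colouring \<open>c\<close> yields a linear extension that starts with the down-closure of the colour
  class 0. It puts \<open>x\<close> below \<open>y\<close> as soon as \<open>x\<close> has colour 0 and no element of the up-set of \<open>y\<close>
  does; for a random colouring with \<open>2 * n\<close> colours this has probability at least \<open>1 / (4 * n)\<close>.\<close>

lemma covering_linear_extensions:
  fixes X :: "'a set"
  assumes X: "finite X" "partial_order_on X r" and Q: "Q \<subseteq> X \<times> X" and n: "n \<ge> 1"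
    and small: "\<And>x y. (x, y) \<in> Q \<Longrightarrow> (y, x) \<notin> r \<and> card {z. (y, z) \<in> r} \<le> n"
    and cardQ: "real (card Q) < exp (real t / (4 * n))"
  shows "\<exists>Ls. (\<forall>L\<in>set Ls. ple X r L) \<and> length Ls = t \<and> (\<forall>(x, y)\<in>Q. \<exists>L\<in>set Ls. (x, y) \<in> L)"
proof -
  note po = partial_order_onD_set[OF X(2)]
  define F where "F = (X \<rightarrow>\<^sub>E {..<2 * n})"
  define P where "P c = (\<lambda>(x, y). c x = 0 \<and> (\<forall>z. (y, z) \<in> r \<longrightarrow> c z \<noteq> 0))" for c :: "'a \<Rightarrow> nat"
  define D where "D c = {w. \<exists>z. (w, z) \<in> r \<and> c z = 0}" for c :: "'a \<Rightarrow> nat"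
  have finF: "finite F" unfolding F_def using X(1) by (intro finite_PiE) auto
  have neF: "F \<noteq> {}" using n by (auto simp: F_def PiE_eq_empty_iff lessThan_empty_iff)
  have finQ: "finite Q" using Q X(1) finite_subset by blast
  have "\<exists>L. ple X r L \<and> D c \<times> (X - D c) \<subseteq> L" for c
  proof -
    have "D c \<subseteq> X" using po(1) by (auto simp: D_def)
    moreover have "(b, a) \<notin> r" if "a \<in> D c" "b \<in> X - D c" for a b
      using that po(4) by (auto simp: D_def dest: transD)
    ultimately show ?thesis using ple_separating[OF X, of "D c" "X - D c"] by blast
  qed
  then obtain L where L: "\<And>c. ple X r (L c)" "\<And>c. D c \<times> (X - D c) \<subseteq> L c" by metis
  have PL: "(x, y) \<in> L c" if "P c (x, y)" "(x, y) \<in> Q" for c x y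
  proof -
    have "(x, x) \<in> r" using that Q po(2) by (auto simp: refl_on_def)
    then have "x \<in> D c" "y \<in> X - D c" using that Q by (auto simp: P_def D_def)
    then show ?thesis using L(2)[of c] by blast
  qed
  have "1 / (4 * n) * card F \<le> card {c \<in> F. P c q}" if q: "q \<in> Q" for q
  proof -
    obtain x y where xy: "q = (x, y)" by (cases q)
    \<comment> \<open>The set that must avoid colour 0 is the up-set of \<open>y\<close>; it does
      not contain \<open>x\<close>, because \<open>(y, x) \<notin> r\<close> for pairs in
      \<open>Q\<close>.\<close>
    have "{c \<in> F. P c q} = {c \<in> F. c x = 0 \<and> (\<forall>z\<in>{z. (y, z) \<in> r}. c z \<noteq> 0)}"
      by (auto simp: P_def xy)
    then show ?thesis
      using card_avoiding_colourings[OF X(1), of x "{z. (y, z) \<in> r}" n] small[of x y] q xy Q po(1) n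
      by (auto simp: F_def)
  qed
  then obtain cs where cs: "set cs \<subseteq> F" "length cs = t"
    "real (card {q \<in> Q. \<forall>c\<in>set cs. \<not> P c q}) \<le> (1 - 1 / (4 * n)) ^ t * card Q"
    using greedy_cover[OF finF neF finQ, of "1 / (4 * n)" P t] n by auto
  \<comment> \<open>By \<open>1 - u <= exp (- u)\<close> and \<open>cardQ\<close>, fewer than one
    pair stays uncovered, hence none.\<close>
  have "(1 - 1 / (4 * real n)) ^ t \<le> exp (- 1 / (4 * n)) ^ t"
    using n exp_ge_add_one_self[of "- 1 / (4 * real n)"] by (intro power_mono) (auto simp: field_simps)
  also have "\<dots> = exp (- (real t / (4 * n)))" by (simp add: exp_of_nat_mult[symmetric])
  finally have "(1 - 1 / (4 * real n)) ^ t * card Q \<le> exp (- (real t / (4 * n))) * card Q"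
    by (intro mult_right_mono) auto
  with cs(3) have "real (card {q \<in> Q. \<forall>c\<in>set cs. \<not> P c q}) \<le> exp (- (real t / (4 * n))) * card Q"
    by simp
  also have "\<dots> < exp (- (real t / (4 * n))) * exp (real t / (4 * n))" using cardQ by simp
  also have "\<dots> = 1" by (simp flip: exp_add)
  finally have "{q \<in> Q. \<forall>c\<in>set cs. \<not> P c q} = {}" using finQ by simp
  then have "\<forall>(x, y)\<in>Q. \<exists>L\<in>set (map L cs). (x, y) \<in> L" using PL by fastforce
  then show ?thesis using L(1) cs(2) by (intro exI[of _ "map L cs"]) auto
qed

section \<open>Degrees and edges of the comparability graph\<close>

lemma comparability_edges_card:
  "e \<in> comparability_edges X r \<Longrightarrow> card e = 2 \<and> e \<subseteq> X"
  by (auto simp: comparability_edges_def)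

lemma finite_comparability_edges:
  "finite X \<Longrightarrow> finite (comparability_edges X r)"
  by (rule finite_subset[of _ "Pow X"]) (auto simp: comparability_edges_def)

lemma card_non_isolated:
  assumes "finite X"
  shows "card (\<Union> (comparability_edges X r)) \<le> 2 * card (comparability_edges X r)"
proof -
  have "card (\<Union> (comparability_edges X r)) \<le> (\<Sum>e\<in>comparability_edges X r. card e)"
    by (rule card_Union_le_sum_card)
  also have "\<dots> = 2 * card (comparability_edges X r)"
    by (simp add: comparability_edges_card)
  finally show ?thesis .
qed

text \<open>Incident edges are counted instead of neighbours, the form suited to double
  counting.\<close>

definition degree :: "'a set \<Rightarrow> 'a rel \<Rightarrow> 'a \<Rightarrow> nat" where
  "degree X r x = card {e \<in> comparability_edges X r. x \<in> e}"

text \<open>Handshake argument: every edge has two ends, of which at most two lie in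
  \<open>H\<close>.\<close>

lemma sum_degree_le:
  assumes "finite X" "H \<subseteq> X"
  shows "(\<Sum>x\<in>H. degree X r x) \<le> 2 * card (comparability_edges X r)"
proof -
  let ?E = "comparability_edges X r"
  have finH: "finite H" using assms finite_subset by blast
  have "(\<Sum>x\<in>H. degree X r x) = (\<Sum>e\<in>?E. card {x \<in> H. x \<in> e})"
    using sum.swap_restrict[OF finH finite_comparability_edges[OF assms(1), of r], of "\<lambda>_ _. 1" "\<lambda>x e. x \<in> e"]
    by (simp only: degree_def card_eq_sum)
  also have "\<dots> \<le> (\<Sum>e\<in>?E. 2)"
  proof (rule sum_mono)
    fix e assume e: "e \<in> ?E"
    then have "finite e" using comparability_edges_card[OF e] by (metis card.infinite zero_neq_numeral)
    then have "card {x \<in> H. x \<in> e} \<le> card e" by (intro card_mono) auto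
    then show "card {x \<in> H. x \<in> e} \<le> 2" using comparability_edges_card[OF e] by simp
  qed
  finally show ?thesis by simp
qed

text \<open>Each \<open>z\<close> strictly above \<open>y\<close> yields its own edge
  \<open>{y, z}\<close>; the extra 1 accounts for \<open>y\<close> itself.\<close>

lemma card_upset_le:
  assumes "finite X" "partial_order_on X r"
  shows "card {z. (y, z) \<in> r} \<le> degree X r y + 1"
proof -
  note po = partial_order_onD_set[OF assms(2)]
  have fin: "finite {z. (y, z) \<in> r}" using po(1) assms(1) by (auto intro: finite_subset[of _ X])
  have "card ({z. (y, z) \<in> r} - {y}) = card ((\<lambda>z. {y, z}) ` ({z. (y, z) \<in> r} - {y}))"
    by (intro card_image[symmetric]) (auto simp: inj_on_def doubleton_eq_iff)
  also have "\<dots> \<le> degree X r y"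
    unfolding degree_def using po(1) finite_comparability_edges[OF assms(1)]
    by (intro card_mono) (auto simp: comparability_edges_def)
  finally show ?thesis using card_Diff1_le[of "{z. (y, z) \<in> r}" y] fin
    by (cases "(y, y) \<in> r") (auto simp: card_Diff_singleton_if split: if_splits)
qed

section \<open>Isolated elements and reduction to the others\<close>

text \<open>Elements outside \<open>C\<close> are comparable only to themselves. One extension puts
  them above \<open>C\<close>, the other puts them below \<open>C\<close> and in reversed order. The
  disjunction is there because the first extension orders a given pair in an unknown
  direction.\<close>

lemma isolated_pair:
  assumes X: "finite X" "partial_order_on X r" and C: "C = \<Union> (comparability_edges X r)"
  shows "\<exists>L L'. ple X r L \<and> ple X r L' \<and> r \<subseteq> L \<and>
    (\<forall>x\<in>X. \<forall>y\<in>X. incomparable r x y \<and> \<not> (x \<in> C \<and> y \<in> C) \<longrightarrow>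
      (x, y) \<in> L \<and> (y, x) \<in> L' \<or> (x, y) \<in> L' \<and> (y, x) \<in> L)"
proof -
  note po = partial_order_onD_set[OF X(2)]
  have CX: "C \<subseteq> X" using comparability_edges_card unfolding C by blast
  define J where "J = X - C"
  have iso: "x = y" if "(x, y) \<in> r" "x \<in> J \<or> y \<in> J" for x y
    using that po(1) unfolding J_def C comparability_edges_def by blast
  have un: "C \<union> J = X" "J \<union> C = X" using CX by (auto simp: J_def)
  have fin: "finite C" "finite J" using CX X(1) finite_subset by (auto simp: J_def)
  obtain M where M: "linear_extension C (Restr r C) M"
    using linear_extension_exists[OF fin(1) po(3,4)] by blast
  obtain N where N: "linear_extension J (Restr r J) N"
    using linear_extension_exists[OF fin(2) po(3,4)] by blast
  have N': "linear_extension J (Restr r J) (N\<inverse>)"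
  proof -
    \<comment> \<open>On \<open>J\<close> the order is contained in the identity, so reversal does
      no harm.\<close>
    have "Restr r J \<subseteq> N\<inverse>"
      using iso N unfolding linear_extension_def by blast
    then show ?thesis using N unfolding linear_extension_def by simp
  qed
  have L: "linear_extension X (Restr r X) (M \<union> N \<union> C \<times> J)"
    using linear_extension_concat[OF M N] iso un(1) by (auto simp: J_def)
  have L': "linear_extension X (Restr r X) (N\<inverse> \<union> M \<union> J \<times> C)"
    using linear_extension_concat[OF N' M] iso un(2) by (auto simp: J_def)
  have tot: "(x, y) \<in> N \<or> (y, x) \<in> N" if "x \<in> J" "y \<in> J" "x \<noteq> y" for x y
    using N that unfolding linear_extension_def linear_order_on_def total_on_def by blast
  show ?thesis
  proof (intro exI conjI ballI impI)
    show "ple X r (M \<union> N \<union> C \<times> J)" "ple X r (N\<inverse> \<union> M \<union> J \<times> C)" using L L' unfolding ple_def by blast+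
    show "r \<subseteq> M \<union> N \<union> C \<times> J" using L po(1) unfolding linear_extension_def by blast
    fix x y assume xy: "x \<in> X" "y \<in> X" "incomparable r x y \<and> \<not> (x \<in> C \<and> y \<in> C)"
    then have "x \<noteq> y" using po(2) by (auto simp: incomparable_def refl_on_def)
    then show "(x, y) \<in> M \<union> N \<union> C \<times> J \<and> (y, x) \<in> N\<inverse> \<union> M \<union> J \<times> C \<or>
      (x, y) \<in> N\<inverse> \<union> M \<union> J \<times> C \<and> (y, x) \<in> M \<union> N \<union> C \<times> J"
      using xy tot[of x y] unfolding J_def by blast
  qed
qed

text \<open>Two extensions settle \<open>r\<close> itself and every pair with an isolated element.
  The pairs that remain lie among at most twice as many elements as there are edges, however large
  \<open>X\<close> is. Covering \<open>(x, y)\<close> suffices, since the assumption also applies to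
  \<open>(y, x)\<close>.\<close>

lemma ldim_le_cover:
  assumes X: "finite X" "X \<noteq> {}" "partial_order_on X r"
    and ple: "\<forall>L\<in>set Ls. ple X r L"
    and cov: "\<And>x y. \<lbrakk>x \<in> \<Union> (comparability_edges X r); y \<in> \<Union> (comparability_edges X r); incomparable r x y\<rbrakk>
      \<Longrightarrow> \<exists>L\<in>set Ls. (x, y) \<in> L"
    and mult: "\<And>x. multiplicity_at Ls x \<le> b"
  shows "ldim X r \<le> b + 2"
proof -
  let ?C = "\<Union> (comparability_edges X r)"
  obtain L L' where L: "ple X r L" "ple X r L'" "r \<subseteq> L"
    "\<forall>x\<in>X. \<forall>y\<in>X. incomparable r x y \<and> \<not> (x \<in> ?C \<and> y \<in> ?C) \<longrightarrow>
      (x, y) \<in> L \<and> (y, x) \<in> L' \<or> (x, y) \<in> L' \<and> (y, x) \<in> L"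
    using isolated_pair[OF X(1,3) refl] by blast
  have "local_realizer X r ([L, L'] @ Ls)"
    unfolding local_realizer_def
  proof (intro conjI ballI impI)
    show "ple X r K" if "K \<in> set ([L, L'] @ Ls)" for K using that L(1,2) ple by auto
    show "\<exists>K\<in>set ([L, L'] @ Ls). (x, y) \<in> K" if "(x, y) \<in> r" for x y using that L(3) by auto
    fix x y assume xy: "x \<in> X" "y \<in> X" "(x, y) \<notin> r \<and> (y, x) \<notin> r"
    then have inc: "incomparable r x y" "incomparable r y x" by (auto simp: incomparable_def)
    show "\<exists>K\<in>set ([L, L'] @ Ls). \<exists>K'\<in>set ([L, L'] @ Ls). (x, y) \<in> K \<and> (y, x) \<in> K'"
    proof (cases "x \<in> ?C \<and> y \<in> ?C")
      case True
      then show ?thesis using cov[OF _ _ inc(1)] cov[OF _ _ inc(2)] by (metis Un_iff set_append)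
    next
      case False
      then show ?thesis using L(4) xy inc by (metis list.set_intros(1,2) Un_iff set_append)
    qed
  qed
  moreover have "multiplicity_at ([L, L'] @ Ls) x \<le> b + 2" for x
    using mult[of x] multiplicity_at_le_length[of "[L, L']" x] unfolding multiplicity_at_append by simp
  ultimately show ?thesis using ldim_le[OF X(1,2)] by blast
qed

section \<open>The bound of order \<open>sqrt m\<close>\<close>

text \<open>The threshold \<open>n\<close> balances two costs: heavy elements form
  \<open>O(m / (n * k))\<close> groups, and light pairs take \<open>O(n * k)\<close> extensions, as
  the logarithm of their number is \<open>O(k)\<close>. With \<open>n * k\<close> of order
  \<open>sqrt m\<close> both are \<open>O(sqrt m)\<close>.\<close>

lemma ldim_le_sqrt_edges:
  fixes X :: "'a set"
  assumes X: "finite X" "partial_order_on X r" and m: "m = card (comparability_edges X r)" "m \<ge> 1"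
  shows "real (ldim X r) \<le> 104 * sqrt m + 4"
proof -
  note po = partial_order_onD_set[OF X(2)]
  let ?C = "\<Union> (comparability_edges X r)"
  have neX: "X \<noteq> {}" using m by (auto simp: comparability_edges_def)
  have CX: "?C \<subseteq> X" using comparability_edges_card by blast
  have finC: "finite ?C" using CX X(1) finite_subset by blast
  \<comment> \<open>Taking \<open>k = k' + 1\<close> makes \<open>k\<close> positive, as division by
    it requires, and yields \<open>sqrt m < 2 ^ k <= 2 * sqrt m\<close>.\<close>
  obtain k' where "4 ^ k' \<le> m" "m < 4 ^ (k' + 1)" using ex_power_ivl1[of 4 m] m(2) by auto
  then obtain k :: nat where k: "k \<ge> 1" "4 ^ k \<le> 4 * m" "m < 4 ^ k"
    by (metis add.commute le_add1 mult_le_mono2 plus_1_eq_Suc power_Suc)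
  define D where "D = sqrt (real m)"
  have D1: "D \<ge> 1" and DD: "D * D = m" using m(2) by (auto simp: D_def)
  have kD: "2 ^ k \<le> 2 * D" "D < 2 ^ k"
  proof -
    have four: "(2 ^ k :: real)\<^sup>2 = 4 ^ k" by (simp add: power2_eq_square flip: power_mult_distrib)
    have r2: "real (4 ^ k) \<le> real (4 * m)" "real m < real (4 ^ k)" using k(2,3) by (auto simp only: of_nat_le_iff of_nat_less_iff)
    show "2 ^ k \<le> 2 * D" by (rule power2_le_imp_le) (use r2 four D1 DD in \<open>auto simp: power2_eq_square\<close>)
    show "D < 2 ^ k" by (rule power2_less_imp_less) (use r2 four DD in \<open>auto simp: power2_eq_square\<close>)
  qed
  \<comment> \<open>The added 1 compensates for rounding down, so that
    \<open>2 ^ k <= n * k\<close>; it raises \<open>n * k\<close> only by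
    \<open>k < 2 ^ k\<close>.\<close>
  define n where "n = 2 ^ k div k + 1"
  have n: "n \<ge> 1" "2 ^ k \<le> n * k" "n * k \<le> 2 * 2 ^ k"
  proof -
    show "n \<ge> 1" by (simp add: n_def)
    show "2 ^ k \<le> n * k" using k(1) dividend_less_div_times[of k "2 ^ k"] by (simp add: n_def)
    have "n * k \<le> 2 ^ k + k" by (simp add: n_def)
    then show "n * k \<le> 2 * 2 ^ k" using less_exp[of k] by linarith
  qed
  define H where "H = {x \<in> ?C. degree X r x \<ge> n}"
  have HX: "H \<subseteq> X" using CX by (auto simp: H_def)
  have "card H * n = (\<Sum>x\<in>H. n)" by simp
  also have "\<dots> \<le> (\<Sum>x\<in>H. degree X r x)" by (intro sum_mono) (auto simp: H_def)
  also have "\<dots> \<le> 2 * m" unfolding m(1) by (rule sum_degree_le[OF X(1) HX])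
  finally have Hn: "card H * n \<le> 2 * m" .
  have groups: "real (card H div k) \<le> 2 * D"
  proof -
    have "card H div k * 2 ^ k \<le> card H div k * (n * k)" using n(2) by (rule mult_le_mono2)
    also have "\<dots> = card H div k * k * n" by simp
    also have "\<dots> \<le> card H * n" by (intro mult_le_mono1) simp
    finally have "card H div k * 2 ^ k \<le> 2 * m" using Hn by linarith
    then have "real (card H div k * 2 ^ k) \<le> real (2 * m)" by (simp only: of_nat_le_iff)
    then have "real (card H div k) * 2 ^ k \<le> 2 * D * D" using DD by simp
    moreover have "real (card H div k) * D \<le> real (card H div k) * 2 ^ k" using kD by (intro mult_left_mono) auto
    ultimately have "real (card H div k) * D \<le> 2 * D * D" by linarith
    then show ?thesis using D1 by simp
  qed
  define Q where "Q = {(x, y) \<in> ?C \<times> ?C. incomparable r x y \<and> x \<notin> H \<and> y \<notin> H}"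
  \<comment> \<open>The factor 24 is \<open>4 * 6\<close>: then \<open>exp (t / (4 * n))\<close> is
    \<open>exp (6 * k)\<close>, at least \<open>2 ^ (6 * k) = 64 ^ k\<close>, which exceeds
    \<open>card Q\<close>.\<close>
  define t where "t = 24 * n * k"
  have "card Q \<le> card (?C \<times> ?C)" unfolding Q_def using finC by (intro card_mono) auto
  also have "\<dots> \<le> (2 * m) * (2 * m)"
    unfolding card_cartesian_product m(1) by (intro mult_le_mono card_non_isolated X(1))
  also have "\<dots> < (2 * 4 ^ k) * (2 * 4 ^ k)" using k(3) m(2) by - (rule mult_strict_mono, auto)
  also have "\<dots> = 4 * 16 ^ k" by (simp flip: power_mult_distrib)
  also have "\<dots> \<le> 4 ^ k * 16 ^ k" using k(1) self_le_power[of "4::nat" k] by auto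
  also have "\<dots> = 64 ^ k" by (simp flip: power_mult_distrib)
  finally have Q64: "real (card Q) < 64 ^ k" by (metis of_nat_less_iff of_nat_numeral of_nat_power)
  also have "\<dots> = (2 ^ 6) ^ k" by simp
  also have "\<dots> \<le> (exp 1 ^ 6) ^ k"
    using exp_ge_add_one_self[of 1] by (intro power_mono) auto
  also have "\<dots> = exp (real t / (4 * n))"
    using n(1) by (simp add: t_def exp_of_nat_mult[symmetric] flip: power_mult)
  finally have cardQ: "real (card Q) < exp (real t / (4 * n))" .
  \<comment> \<open>A light \<open>y\<close> has degree at most \<open>n - 1\<close>, so its up-set,
    with \<open>y\<close> included, has at most \<open>n\<close> elements.\<close>
  have "(y, x) \<notin> r \<and> card {z. (y, z) \<in> r} \<le> n" if "(x, y) \<in> Q" for x y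
    using that card_upset_le[OF X, of y] by (auto simp: Q_def H_def incomparable_def)
  moreover have "Q \<subseteq> X \<times> X" using CX by (auto simp: Q_def)
  ultimately obtain Ts where Ts: "\<forall>L\<in>set Ts. ple X r L" "length Ts = t" "\<forall>(x, y)\<in>Q. \<exists>L\<in>set Ts. (x, y) \<in> L"
    using covering_linear_extensions[OF X _ n(1) _ cardQ] by blast
  obtain Gs where Gs: "\<forall>L\<in>set Gs. ple X r L"
    "\<forall>x\<in>H. \<forall>y\<in>X. incomparable r x y \<longrightarrow> (\<exists>L\<in>set Gs. (x, y) \<in> L) \<and> (\<exists>L\<in>set Gs. (y, x) \<in> L)"
    "\<And>x. multiplicity_at Gs x \<le> 2 * (card H div k + 1 + 2 ^ k)"
    using grouped_ples[OF X HX k(1)] by blast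
  have "ldim X r \<le> t + 2 * (card H div k + 1 + 2 ^ k) + 2"
  proof (rule ldim_le_cover[OF X(1) neX X(2), of "Ts @ Gs"])
    show "\<forall>L\<in>set (Ts @ Gs). ple X r L" using Ts(1) Gs(1) by auto
    show "multiplicity_at (Ts @ Gs) x \<le> t + 2 * (card H div k + 1 + 2 ^ k)" for x
      using Gs(3)[of x] multiplicity_at_le_length[of Ts x] Ts(2) by simp
    fix x y assume xy: "x \<in> ?C" "y \<in> ?C" "incomparable r x y"
    show "\<exists>L\<in>set (Ts @ Gs). (x, y) \<in> L"
    proof (cases "x \<in> H \<or> y \<in> H")
      case True
      then show ?thesis using Gs(2) xy CX incomparable_commute[of r x y] by (metis Un_iff set_append subsetD)
    next
      case False
      then have "(x, y) \<in> Q" using xy by (auto simp: Q_def)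
      then show ?thesis using Ts(3) by auto
    qed
  qed
  then have "real (ldim X r) \<le> real (t + 2 * (card H div k + 1 + 2 ^ k) + 2)" by (simp only: of_nat_le_iff)
  then have "real (ldim X r) \<le> real t + 2 * (real (card H div k) + 1 + 2 ^ k) + 2" by simp
  moreover have "real t \<le> 24 * (2 * 2 ^ k)"
  proof -
    have "t \<le> 24 * (2 * 2 ^ k)" using n(3) by (simp add: t_def mult.commute)
    then have "real t \<le> real (24 * (2 * 2 ^ k))" by (simp only: of_nat_le_iff)
    then show ?thesis by simp
  qed
  \<comment> \<open>The constant is \<open>96 + 4 + 4\<close>, the shares of \<open>s\<close>,
    \<open>c\<close> and \<open>p\<close>. Naming the quantities leaves a purely linear
    problem.\<close>
  moreover have "l \<le> 104 * D + 4"
    if "l \<le> s + 2 * (c + 1 + p) + 2" "s \<le> 24 * (2 * p)" "c \<le> 2 * D" "p \<le> 2 * D" for l s c p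
    using that by argo
  ultimately show ?thesis using groups kD(1) unfolding D_def[symmetric] by blast
qed

text \<open>For \<open>m = 1\<close> the iterated logarithm is 0 and the target is only 7, below the
  general bound 108. The two elements of the single edge are comparable, so no pair is left to
  cover.\<close>

lemma ldim_le_2:
  assumes X: "finite X" "partial_order_on X r" and m: "card (comparability_edges X r) = 1"
  shows "ldim X r \<le> 2"
proof -
  obtain e where e: "comparability_edges X r = {e}" using m card_1_singletonE by blast
  then have "e \<in> comparability_edges X r" by simp
  then obtain a b where ab: "e = {a, b}" "a \<in> X" "b \<in> X" "(a, b) \<in> r \<or> (b, a) \<in> r"
    unfolding comparability_edges_def by blast
  have "\<not> incomparable r x y" if "x \<in> {a, b}" "y \<in> {a, b}" for x y
    using that ab partial_order_onD_set(2)[OF X(2)] by (auto simp: incomparable_def refl_on_def)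
  then have "ldim X r \<le> 0 + 2"
    using ab e by (intro ldim_le_cover[OF X(1) _ X(2), of "[]"]) (auto simp: multiplicity_at_def)
  then show ?thesis by simp
qed

section \<open>The iterated logarithm\<close>

text \<open>Ensures that the minimum in \<open>log_star\<close> is attained. Above 2 the logarithm
  lowers its argument by at least 1, and from the interval between 1 and 2 one application reaches
  1, so induction on an integer bound works.\<close>

lemma iterated_log_le_1: "\<exists>k. (log 2 ^^ k) x \<le> 1"
proof -
  have "\<exists>k. (log 2 ^^ k) x \<le> 1" if "x \<le> real n + 1" for n x
    using that
  proof (induction n arbitrary: x)
    case 0
    then show ?case by (intro exI[of _ 0]) simp
  next
    case (Suc n)
    show ?case
    proof (cases "x \<le> 1")
      case True
      then show ?thesis by (intro exI[of _ 0]) simp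
    next
      case False
      have "\<exists>k. (log 2 ^^ k) (log 2 x) \<le> 1"
      proof (cases "x \<le> 2")
        case True
        then show ?thesis using \<open>\<not> x \<le> 1\<close> by (intro exI[of _ 0]) (simp add: log_le_iff)
      next
        case False
        define y where "y = x / 2 - 1"
        have x: "x = 2 * (1 + y)" "y \<ge> 0" using False by (auto simp: y_def)
        \<comment> \<open>The goal is
          \<open>log 2 x = 1 + log 2 (1 + y) <= 1 + 2 * y = x - 1\<close>, which uses
          \<open>ln 2 >= 1 / 2\<close>.\<close>
        have le: "log 2 (1 + y) \<le> y / ln 2"
          unfolding log_def using ln_add_one_self_le_self[OF x(2)] by (intro divide_right_mono) auto
        have "ln (1 / 2) \<le> (1 / 2 :: real) - 1" by (rule ln_le_minus_one) simp
        then have "1 / 2 \<le> ln (2 :: real)" by (simp add: ln_div)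
        then have "y / ln 2 \<le> 2 * y"
          using x(2) mult_right_mono[of "1/2" "ln 2" y] by (simp add: field_simps)
        with le have "log 2 x \<le> x - 1" using x log_mult[of 2 "1 + y" 2] by (simp add: mult.commute)
        then show ?thesis using Suc by simp
      qed
      then obtain k where "(log 2 ^^ k) (log 2 x) \<le> 1" by blast
      then show ?thesis by (intro exI[of _ "Suc k"]) (simp add: funpow_swap1)
    qed
  qed
  moreover have "x \<le> real (nat \<lceil>x\<rceil>) + 1" using real_nat_ceiling_ge[of x] by linarith
  ultimately show ?thesis by blast
qed

text \<open>Supplies an exponent of at least 13 in the final estimate when
  \<open>m > 1\<close>.\<close>

lemma log_star_pos:
  assumes "x > 1"
  shows "log_star x \<ge> 1"
proof -
  have "(log 2 ^^ log_star x) x \<le> 1"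
    unfolding log_star_def using iterated_log_le_1 by (rule LeastI_ex)
  then have "log_star x \<noteq> 0" using assms by (intro notI) simp
  then show ?thesis by simp
qed

theorem corollary10:
  fixes X :: "'a set" and r :: "'a rel" and m :: nat
  assumes "finite X"
    and "partial_order_on X r"
    and "m = card (comparability_edges X r)"
    and "m \<ge> 1"
  shows "real (ldim X r) \<le> (2 ^ (13 * log_star (sqrt (real m))) + 2) * (2 * sqrt (real m)) + 1"
proof (cases "m = 1")
  case True
  have "ldim X r \<le> 2" using ldim_le_2[OF assms(1,2)] assms(3) True by simp
  \<comment> \<open>\<open>P\<close> stands for the power of 2; since \<open>sqrt 1 = 1\<close>,
    nonnegativity of \<open>P\<close> already makes the right side at least 5.\<close>
  then have "real (ldim X r) \<le> (P + 2) * (2 * 1) + 1" if "P \<ge> 0" for P :: real using that by simp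
  then show ?thesis using True by (metis of_nat_1 real_sqrt_one zero_le_numeral zero_le_power)
next
  case False
  define D where "D = sqrt (real m)"
  have D: "D > 1" using False assms(4) by (simp add: D_def)
  have "(2::real) ^ 13 \<le> 2 ^ (13 * log_star D)"
    using log_star_pos[OF D] by (intro power_increasing) auto
  \<comment> \<open>As \<open>2 ^ 13 = 8192\<close>, the target is at least
    \<open>16384 * D + 1\<close>, which exceeds \<open>104 * D + 4\<close> for
    \<open>D > 1\<close>.\<close>
  then have "8192 * (2 * D) \<le> (2 ^ (13 * log_star D) + 2) * (2 * D)"
    using D by (intro mult_right_mono) auto
  moreover have "real (ldim X r) \<le> 104 * D + 4"
    using ldim_le_sqrt_edges[OF assms] by (simp add: D_def)
  ultimately show ?thesis using D unfolding D_def[symmetric] by linarith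
qed

end
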